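(* Let $m\geq 2$ and $n\geq 2$ be integers, let $P_m$ be the path of order $m$ and $K_n$ the complete graph of order $n$. Then $rvcl(P_m\diamond K_n)=\max\{rvc(P_m),\,n+2\}$.
   Context: All graphs are finite, simple, connected and undirected; $d$ denotes graph distance. A rainbow vertex $k$-coloring of $G$ is a map $c:V(G)\to\{1,\dots,k\}$ such that every two vertices are joined by a path whose internal vertices all receive distinct colors; $rvc(G)$ is the least $k$ for which $G$ has one. For such $c$ let $R_i=c^{-1}(i)$; the rainbow code of $v$ is $(d(v,R_1),\dots,d(v,R_k))$ with $d(v,R_i)=\min_{x\in R_i}d(v,x)$. A locating rainbow $k$-coloring is a rainbow vertex $k$-coloring in which distinct vertices have distinct rainbow codes; $rvcl(G)$ is the least $k$ for which one exists. For graphs $G_m$ (order $m$) and $H_n$ (order $n$) on disjoint vertex sets, the edge corona $G_m\diamond H_n$ is obtained from one copy of $G_m$ and $|E(G_m)|$ vertex-disjoint copies of $H_n$, one per edge of $G_m$, by joining both end vertices of the $j$-th edge of $G_m$ to every vertex of the $j$-th copy of $H_n$. *)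

theory Defs
  imports Main "HOL-Library.Extended_Nat"
begin

text \<open>A graph is given by a vertex set V and a symmetric irreflexive adjacency relation E.\<close>

definition is_path :: "'a set \<Rightarrow> ('a \<Rightarrow> 'a \<Rightarrow> bool) \<Rightarrow> 'a list \<Rightarrow> 'a \<Rightarrow> 'a \<Rightarrow> bool" where
  "is_path V E p u v \<longleftrightarrow> p \<noteq> [] \<and> hd p = u \<and> last p = v \<and> set p \<subseteq> V \<and> distinct p
     \<and> (\<forall>i. Suc i < length p \<longrightarrow> E (p ! i) (p ! Suc i))"

text \<open>Graph distance (length of a shortest path), infinite if no path exists.\<close>
definition gdist :: "'a set \<Rightarrow> ('a \<Rightarrow> 'a \<Rightarrow> bool) \<Rightarrow> 'a \<Rightarrow> 'a \<Rightarrow> enat" where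
  "gdist V E u v = Inf {enat (length p - 1) | p. is_path V E p u v}"

definition set_dist :: "'a set \<Rightarrow> ('a \<Rightarrow> 'a \<Rightarrow> bool) \<Rightarrow> 'a \<Rightarrow> 'a set \<Rightarrow> enat" where
  "set_dist V E v R = Inf {gdist V E v x | x. x \<in> R}"

definition rainbow_vertex_coloring :: "'a set \<Rightarrow> ('a \<Rightarrow> 'a \<Rightarrow> bool) \<Rightarrow> nat \<Rightarrow> ('a \<Rightarrow> nat) \<Rightarrow> bool" where
  "rainbow_vertex_coloring V E k c \<longleftrightarrow>
     (\<forall>v\<in>V. c v \<in> {1..k}) \<and>
     (\<forall>u\<in>V. \<forall>v\<in>V. u \<noteq> v \<longrightarrow>
        (\<exists>p. is_path V E p u v \<and> inj_on c (set (butlast (tl p)))))"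

definition rvc :: "'a set \<Rightarrow> ('a \<Rightarrow> 'a \<Rightarrow> bool) \<Rightarrow> nat" where
  "rvc V E = (LEAST k. \<exists>c. rainbow_vertex_coloring V E k c)"

definition rainbow_code :: "'a set \<Rightarrow> ('a \<Rightarrow> 'a \<Rightarrow> bool) \<Rightarrow> nat \<Rightarrow> ('a \<Rightarrow> nat) \<Rightarrow> 'a \<Rightarrow> enat list" where
  "rainbow_code V E k c v = map (\<lambda>i. set_dist V E v {x\<in>V. c x = i}) [1..<k+1]"

definition locating_rainbow_coloring :: "'a set \<Rightarrow> ('a \<Rightarrow> 'a \<Rightarrow> bool) \<Rightarrow> nat \<Rightarrow> ('a \<Rightarrow> nat) \<Rightarrow> bool" where
  "locating_rainbow_coloring V E k c \<longleftrightarrow> rainbow_vertex_coloring V E k c \<and>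
     (\<forall>u\<in>V. \<forall>v\<in>V. u \<noteq> v \<longrightarrow> rainbow_code V E k c u \<noteq> rainbow_code V E k c v)"

definition rvcl :: "'a set \<Rightarrow> ('a \<Rightarrow> 'a \<Rightarrow> bool) \<Rightarrow> nat" where
  "rvcl V E = (LEAST k. \<exists>c. locating_rainbow_coloring V E k c)"

definition graph_edges :: "'a set \<Rightarrow> ('a \<Rightarrow> 'a \<Rightarrow> bool) \<Rightarrow> 'a set set" where
  "graph_edges V E = {{u, v} | u v. u \<in> V \<and> v \<in> V \<and> E u v}"

text \<open>Edge corona: vertex Inl a is vertex a of G; vertex Inr (e, h) is vertex h of the copy of H
  attached to the edge e of G.\<close>
definition corona_verts :: "'a set \<Rightarrow> ('a \<Rightarrow> 'a \<Rightarrow> bool) \<Rightarrow> 'b set \<Rightarrow> ('a + 'a set \<times> 'b) set" where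
  "corona_verts VG EG VH = Inl ` VG \<union> Inr ` (graph_edges VG EG \<times> VH)"

fun corona_adj :: "('a \<Rightarrow> 'a \<Rightarrow> bool) \<Rightarrow> ('b \<Rightarrow> 'b \<Rightarrow> bool) \<Rightarrow> ('a + 'a set \<times> 'b) \<Rightarrow> ('a + 'a set \<times> 'b) \<Rightarrow> bool" where
  "corona_adj EG EH (Inl a) (Inl b) = EG a b"
| "corona_adj EG EH (Inr (e, h)) (Inr (e', h')) = (e = e' \<and> EH h h')"
| "corona_adj EG EH (Inl a) (Inr (e, h)) = (a \<in> e)"
| "corona_adj EG EH (Inr (e, h)) (Inl a) = (a \<in> e)"

definition path_verts :: "nat \<Rightarrow> nat set" where "path_verts m = {0..<m}"
definition path_adj :: "nat \<Rightarrow> nat \<Rightarrow> bool" where "path_adj i j \<longleftrightarrow> i + 1 = j \<or> j + 1 = i"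
definition complete_verts :: "nat \<Rightarrow> nat set" where "complete_verts n = {0..<n}"
definition complete_adj :: "nat \<Rightarrow> nat \<Rightarrow> bool" where "complete_adj i j \<longleftrightarrow> i \<noteq> j"

end

theory Submission
  imports Defs
begin

text \<open>
  Let \<open>a\<^sub>0, \<dots>, a\<^sub>m\<^sub>-\<^sub>1\<close> be the path and \<open>K\<^sub>j\<close> the clique on the edge \<open>a\<^sub>j\<^sub>-\<^sub>1 a\<^sub>j\<close>.

  Lower bound: the inner \<open>a\<^sub>i\<close> are cut vertices, so they have distinct colours, which is exactly what a
  rainbow colouring of the path requires. The vertices of \<open>K\<^sub>1 \<union> {a\<^sub>0}\<close> are twins, so they use
  \<open>n + 1\<close> colours; if there were no others, \<open>a\<^sub>1\<close> would have the code of the vertex of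
  \<open>K\<^sub>1 \<union> {a\<^sub>0}\<close> that shares its colour.

  Upper bound: colour 1 is given to \<open>a\<^sub>0\<close> and (if \<open>m > 2\<close>) \<open>a\<^sub>1\<close> only, so that the distance to it
  determines the position along the path, except that positions 1 and 2 are confused. The colours on
  \<open>K\<^sub>j \<union> {a\<^sub>j}\<close> are distinct, and colour \<open>n + 2\<close> separates \<open>K\<^sub>1 \<union> {a\<^sub>0}\<close>, which is not adjacent to it,
  from \<open>K\<^sub>2 \<union> {a\<^sub>1, a\<^sub>2}\<close>.
\<close>

section \<open>Paths and distances\<close>

lemma is_path_iff_successively:
  "is_path V E p u v \<longleftrightarrow>
     p \<noteq> [] \<and> hd p = u \<and> last p = v \<and> set p \<subseteq> V \<and> distinct p \<and> successively E p"
  unfolding is_path_def successively_conv_nth by auto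

lemma is_path_rev:
  assumes "is_path V E p u v" and "\<And>x y. E x y \<Longrightarrow> E y x"
  shows "is_path V E (rev p) v u"
proof -
  have "successively (\<lambda>x y. E y x) p"
    using assms unfolding is_path_iff_successively by (blast intro: successively_mono)
  then show ?thesis
    using assms(1) unfolding is_path_iff_successively
    by (simp add: hd_rev last_rev successively_rev)
qed

text \<open>A walk that starts in \<open>P\<close> and ends outside leaves \<open>P\<close> at some
  step. Taking "position at most \<open>i\<close>" for \<open>P\<close> locates cut
  vertices.\<close>

lemma successively_crossing:
  assumes "successively E p" "p \<noteq> []" "P (hd p)" "\<not> P (last p)"
  shows "\<exists>x\<in>set p. \<exists>y\<in>set p. E x y \<and> P x \<and> \<not> P y"
  using assms
proof (induction p rule: induct_list012)
  case (3 x y zs)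
  then show ?case by (cases "P y") auto
qed auto

lemma successively_lipschitz:
  fixes f :: "'a \<Rightarrow> nat"
  assumes "successively E p" "p \<noteq> []"
    and "\<And>x y. x \<in> set p \<Longrightarrow> y \<in> set p \<Longrightarrow> E x y \<Longrightarrow> f x \<le> Suc (f y)"
  shows "f (hd p) \<le> f (last p) + (length p - 1)"
  using assms
proof (induction p rule: induct_list012)
  case (3 x y zs)
  have "f y \<le> f (last (y # zs)) + length zs"
    using "3.IH"(2) "3.prems" by simp
  moreover have "f x \<le> Suc (f y)"
    using "3.prems" by simp
  ultimately show ?case by simp
qed auto

lemma gdist_le: "is_path V E p u v \<Longrightarrow> gdist V E u v \<le> enat (length p - 1)"
  unfolding gdist_def by (intro Inf_lower) auto

text \<open>Strict bounds on an infimum are witnessed by a single path, so it need not be shown that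
  a shortest path exists.\<close>

lemma gdist_less_iff:
  "gdist V E u v < t \<longleftrightarrow> (\<exists>p. is_path V E p u v \<and> enat (length p - 1) < t)"
  unfolding gdist_def Inf_less_iff by auto

lemma set_dist_less_iff: "set_dist V E v R < t \<longleftrightarrow> (\<exists>x\<in>R. gdist V E v x < t)"
  unfolding set_dist_def Inf_less_iff by auto

lemma set_dist_le: "x \<in> R \<Longrightarrow> set_dist V E v R \<le> gdist V E v x"
  unfolding set_dist_def by (intro Inf_lower) auto

lemma gdist_less_1_iff: "u \<in> V \<Longrightarrow> gdist V E u v < 1 \<longleftrightarrow> u = v"
proof
  assume "gdist V E u v < 1"
  then obtain p where p: "is_path V E p u v" "length p \<le> 1"
    unfolding gdist_less_iff by (auto simp: one_enat_def)
  then show "u = v"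
    by (cases p) (auto simp: is_path_def)
next
  assume "u \<in> V" "u = v"
  then have "is_path V E [u] u v"
    by (simp add: is_path_def)
  then show "gdist V E u v < 1"
    unfolding gdist_less_iff by (intro exI[of _ "[u]"]) (simp add: one_enat_def)
qed

lemma gdist_less_2_iff:
  assumes "u \<in> V" "v \<in> V"
  shows "gdist V E u v < 2 \<longleftrightarrow> u = v \<or> E u v"
proof
  assume "gdist V E u v < 2"
  then obtain p where p: "is_path V E p u v" "length p \<le> 2"
    unfolding gdist_less_iff by (auto simp: numeral_eq_enat)
  then consider "p = [u]" "u = v" | "p = [u, v]"
    by (cases p; cases "tl p") (auto simp: is_path_def)
  then show "u = v \<or> E u v"
    using p(1) by cases (auto simp: is_path_iff_successively)
next
  assume *: "u = v \<or> E u v"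
  show "gdist V E u v < 2"
  proof (cases "u = v")
    case True
    then have "gdist V E u v < 1"
      using gdist_less_1_iff[OF assms(1)] by metis
    also have "(1::enat) < 2" by simp
    finally show ?thesis .
  next
    case False
    then have "is_path V E [u, v] u v"
      using * assms by (simp add: is_path_iff_successively)
    then show ?thesis
      unfolding gdist_less_iff by (intro exI[of _ "[u, v]"]) (simp add: numeral_eq_enat)
  qed
qed

lemma set_dist_less_1_iff: "v \<in> V \<Longrightarrow> set_dist V E v R < 1 \<longleftrightarrow> v \<in> R"
  by (auto simp: set_dist_less_iff gdist_less_1_iff)

lemma set_dist_less_2_iff:
  "v \<in> V \<Longrightarrow> R \<subseteq> V \<Longrightarrow> set_dist V E v R < 2 \<longleftrightarrow> v \<in> R \<or> (\<exists>x\<in>R. E v x)"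
  by (auto simp: set_dist_less_iff gdist_less_2_iff subset_iff)

text \<open>A potential that drops by at most one per edge bounds the distance from below; with
  \<open>level\<close> as potential this controls the distance to colour 1.\<close>

lemma gdist_ge_lipschitz:
  fixes f :: "'a \<Rightarrow> nat"
  assumes "\<And>x y. x \<in> V \<Longrightarrow> y \<in> V \<Longrightarrow> E x y \<Longrightarrow> f x \<le> Suc (f y)"
  shows "enat (f u - f v) \<le> gdist V E u v"
  unfolding gdist_def
proof (rule Inf_greatest, clarify)
  fix p assume p: "is_path V E p u v"
  then have "f (hd p) \<le> f (last p) + (length p - 1)"
    using assms by (intro successively_lipschitz[of E]) (auto simp: is_path_iff_successively)
  with p show "enat (f u - f v) \<le> enat (length p - 1)"
    by (simp add: is_path_def)
qed

section \<open>Rainbow codes\<close>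

lemma rainbow_code_eq_iff:
  "rainbow_code V E k c u = rainbow_code V E k c v \<longleftrightarrow>
     (\<forall>i\<in>{1..k}. set_dist V E u {x\<in>V. c x = i} = set_dist V E v {x\<in>V. c x = i})"
  unfolding rainbow_code_def by (auto simp: Ball_def)

lemma rainbow_code_eq_imp_color_eq:
  assumes "u \<in> V" "v \<in> V" "c u \<in> {1..k}" "rainbow_code V E k c u = rainbow_code V E k c v"
  shows "c u = c v"
proof -
  let ?R = "{x\<in>V. c x = c u}"
  have "set_dist V E u ?R < 1"
    using assms(1) by (simp add: set_dist_less_1_iff)
  then have "set_dist V E v ?R < 1"
    using assms(3,4) by (simp add: rainbow_code_eq_iff)
  then show ?thesis
    using assms(2) by (simp add: set_dist_less_1_iff)
qed

text \<open>All entries of both codes are 0 or 1, and 0 occurs only at the vertex's own colour, so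
  here the colour determines the code.\<close>

lemma rainbow_code_eq_if_near:
  assumes "u \<in> V" "v \<in> V" "c u = c v"
    and "\<And>i. i \<in> {1..k} \<Longrightarrow> set_dist V E u {x\<in>V. c x = i} < 2"
    and "\<And>i. i \<in> {1..k} \<Longrightarrow> set_dist V E v {x\<in>V. c x = i} < 2"
  shows "rainbow_code V E k c u = rainbow_code V E k c v"
proof -
  have enat_eq: "a = b" if "a < 2" "b < 2" "a < 1 \<longleftrightarrow> b < 1" for a b :: enat
    using that by (cases a; cases b) (auto simp: numeral_eq_enat one_enat_def)
  show ?thesis
    unfolding rainbow_code_eq_iff
  proof
    fix i assume "i \<in> {1..k}"
    then show "set_dist V E u {x\<in>V. c x = i} = set_dist V E v {x\<in>V. c x = i}"
      using assms by (intro enat_eq) (auto simp: set_dist_less_1_iff)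
  qed
qed

text \<open>A path from \<open>u\<close> yields one from \<open>v\<close> that is no longer: if it
  visits \<open>v\<close>, keep the part from \<open>v\<close> on; otherwise replace its first
  vertex by \<open>v\<close>. As \<open>x \<noteq> u\<close>, there is a second vertex to attach
  to.\<close>

lemma gdist_twin_le:
  assumes "v \<in> V" "x \<noteq> u"
    and nb: "\<And>w. w \<in> V \<Longrightarrow> w \<noteq> u \<Longrightarrow> w \<noteq> v \<Longrightarrow> E u w \<Longrightarrow> E v w"
  shows "gdist V E v x \<le> gdist V E u x"
proof -
  have "\<exists>q. is_path V E q v x \<and> length q \<le> length p" if p: "is_path V E p u x" for p
  proof (cases "v \<in> set p")
    case True
    then obtain ys zs where "p = ys @ v # zs"
      by (auto simp: in_set_conv_decomp)
    with p have "is_path V E (v # zs) v x" "length (v # zs) \<le> length p"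
      by (auto simp: is_path_iff_successively successively_append_iff split: if_splits)
    then show ?thesis by blast
  next
    case False
    from p obtain q where q: "p = u # q"
      by (cases p) (auto simp: is_path_def)
    with p assms(2) have "q \<noteq> []"
      by (auto simp: is_path_def)
    with p q False nb[of "hd q"] assms(1) have "is_path V E (v # q) v x"
      by (cases q) (auto simp: is_path_iff_successively)
    then show ?thesis using q by auto
  qed
  then have "\<exists>q. is_path V E q v x \<and> enat (length q - 1) \<le> enat (length p - 1)"
    if "is_path V E p u x" for p
    using that diff_le_mono by (metis enat_ord_simps(1))
  then show ?thesis
    unfolding gdist_def by (intro Inf_mono) blast
qed

lemma rainbow_code_twins:
  assumes "u \<in> V" "v \<in> V" "c u = c v"
    and nb: "\<And>w. w \<in> V \<Longrightarrow> w \<noteq> u \<Longrightarrow> w \<noteq> v \<Longrightarrow> E u w \<longleftrightarrow> E v w"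
  shows "rainbow_code V E k c u = rainbow_code V E k c v"
  unfolding rainbow_code_eq_iff
proof
  fix i assume "i \<in> {1..k}"
  let ?R = "{x\<in>V. c x = i}"
  show "set_dist V E u ?R = set_dist V E v ?R"
  proof (cases "c u = i")
    case True
    then have "set_dist V E u ?R < 1" "set_dist V E v ?R < 1"
      using assms by (auto simp: set_dist_less_1_iff)
    then show ?thesis
      by (cases "set_dist V E u ?R"; cases "set_dist V E v ?R") (auto simp: one_enat_def)
  next
    case False
    \<comment> \<open>A vertex of another colour is neither \<open>u\<close> nor \<open>v\<close>,
      so the twin bound applies in both directions.\<close>
    have "gdist V E u x = gdist V E v x" if "x \<in> ?R" for x
      using False that assms by (intro antisym gdist_twin_le) auto
    then have "{gdist V E u x |x. x \<in> ?R} = {gdist V E v x |x. x \<in> ?R}"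
      by (intro Collect_cong ex_cong1) auto
    then show ?thesis
      by (simp add: set_dist_def)
  qed
qed

section \<open>Paths\<close>

lemma path_adj_crossing:
  assumes "is_path (path_verts m) path_adj p u v" "u \<le> i" "i < v"
  shows "i \<in> set p"
proof -
  from assms obtain x y where "x \<in> set p" "path_adj x y" "x \<le> i" "\<not> y \<le> i"
    using successively_crossing[of path_adj p "\<lambda>x. x \<le> i"]
    by (auto simp: is_path_iff_successively)
  then have "x = i"
    by (auto simp: path_adj_def)
  then show ?thesis
    using \<open>x \<in> set p\<close> by simp
qed

lemma mem_internal:
  assumes "is_path V E p u v" "x \<in> set p" "x \<noteq> u" "x \<noteq> v"
  shows "x \<in> set (butlast (tl p))"
proof -
  from assms obtain q where q: "p = u # q"
    by (cases p) (auto simp: is_path_def)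
  with assms have "q \<noteq> []" "last q = v" "x \<in> set q"
    by (auto simp: is_path_def split: if_splits)
  then show ?thesis
    using assms(4) q by (cases q rule: rev_cases) auto
qed

text \<open>Any path between the two ends passes through all inner vertices; conversely, the
  interval joining two vertices has only inner vertices inside.\<close>

lemma rvc_coloring_path_iff:
  assumes "m \<ge> 1"
  shows "rainbow_vertex_coloring (path_verts m) path_adj k c \<longleftrightarrow>
    c ` {..<m} \<subseteq> {1..k} \<and> inj_on c {1..<m-1}"
proof
  assume L: "rainbow_vertex_coloring (path_verts m) path_adj k c"
  have "inj_on c {1..<m-1}"
  proof (cases "m = 1")
    case False
    with assms have "0 \<in> path_verts m" "m - 1 \<in> path_verts m" "0 \<noteq> m - 1"
      by (auto simp: path_verts_def)
    with L obtain p where p: "is_path (path_verts m) path_adj p 0 (m-1)"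
      "inj_on c (set (butlast (tl p)))"
      unfolding rainbow_vertex_coloring_def by blast
    have "{1..<m-1} \<subseteq> set (butlast (tl p))"
      using mem_internal[OF p(1)] path_adj_crossing[OF p(1)] by auto
    with p(2) show ?thesis by (rule inj_on_subset)
  qed simp
  with L show "c ` {..<m} \<subseteq> {1..k} \<and> inj_on c {1..<m-1}"
    by (auto simp: rainbow_vertex_coloring_def path_verts_def)
next
  assume R: "c ` {..<m} \<subseteq> {1..k} \<and> inj_on c {1..<m-1}"
  have up: "is_path (path_verts m) path_adj [u..<Suc v] u v"
    "set (butlast (tl [u..<Suc v])) \<subseteq> {1..<m-1}" if "u < v" "v < m" for u v
    using that by (auto simp: is_path_def path_verts_def path_adj_def tl_upt nth_append not_less)
  have "\<exists>p. is_path (path_verts m) path_adj p u v \<and> inj_on c (set (butlast (tl p)))"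
    if "u < m" "v < m" "u \<noteq> v" for u v
  proof (cases "u < v")
    case True
    with up[OF True] that R show ?thesis by (meson inj_on_subset)
  next
    case False
    with that have "v < u" by simp
    have "is_path (path_verts m) path_adj (rev [v..<Suc u]) u v"
      by (rule is_path_rev[OF up(1)]) (use that \<open>v < u\<close> in \<open>auto simp: path_adj_def\<close>)
    moreover have "set (butlast (tl (rev [v..<Suc u]))) = set (butlast (tl [v..<Suc u]))"
      by (metis butlast_rev butlast_tl rev_swap set_rev)
    ultimately show ?thesis
      using up(2)[OF \<open>v < u\<close>] that R by (metis inj_on_subset)
  qed
  with R show "rainbow_vertex_coloring (path_verts m) path_adj k c"
    by (auto simp: rainbow_vertex_coloring_def path_verts_def image_subset_iff)
qed

lemma rvc_path_le:
  assumes "m \<ge> 1" "c ` {..<m} \<subseteq> {1..k}" "inj_on c {1..<m-1}"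
  shows "rvc (path_verts m) path_adj \<le> k"
  unfolding rvc_def using assms by (intro Least_le exI[of _ c]) (simp add: rvc_coloring_path_iff)

lemma rvc_path_ge:
  assumes "m \<ge> 1"
  shows "m - 2 \<le> rvc (path_verts m) path_adj"
proof -
  \<comment> \<open>The injective colouring \<open>Suc\<close> with \<open>m\<close> colours shows
    that the minimum is attained.\<close>
  have "\<exists>k c. rainbow_vertex_coloring (path_verts m) path_adj k c"
    using assms by (intro exI[of _ m] exI[of _ Suc]) (auto simp: rvc_coloring_path_iff)
  then have "\<exists>c. rainbow_vertex_coloring (path_verts m) path_adj (rvc (path_verts m) path_adj) c"
    unfolding rvc_def by (rule LeastI_ex)
  then obtain c where "rainbow_vertex_coloring (path_verts m) path_adj (rvc (path_verts m) path_adj) c" ..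
  then have c: "c ` {..<m} \<subseteq> {1..rvc (path_verts m) path_adj}" "inj_on c {1..<m-1}"
    using assms by (auto simp: rvc_coloring_path_iff)
  then have "card {1..<m-1} \<le> card {1..rvc (path_verts m) path_adj}"
    by (intro card_inj_on_le[of c]) (auto simp: image_subset_iff)
  then show ?thesis by simp
qed

section \<open>The edge corona of a path with a complete graph\<close>

abbreviation pk_verts :: "nat \<Rightarrow> nat \<Rightarrow> (nat + nat set \<times> nat) set" where
  "pk_verts m n \<equiv> corona_verts (path_verts m) path_adj (complete_verts n)"

abbreviation pk_adj :: "nat + nat set \<times> nat \<Rightarrow> nat + nat set \<times> nat \<Rightarrow> bool" where
  "pk_adj \<equiv> corona_adj path_adj complete_adj"

text \<open>Indices are shifted: \<open>clq j h\<close> lies in the clique on the edge from \<open>j\<close> to \<open>j + 1\<close>, hence on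
  level \<open>j + 1\<close>.\<close>

definition clq :: "nat \<Rightarrow> nat \<Rightarrow> nat + nat set \<times> nat" where
  "clq j h = Inr ({j, Suc j}, h)"

lemma mem_pk_verts:
  "x \<in> pk_verts m n \<longleftrightarrow> (\<exists>i<m. x = Inl i) \<or> (\<exists>j h. Suc j < m \<and> h < n \<and> x = clq j h)"
proof -
  have "graph_edges (path_verts m) path_adj = {{j, Suc j} |j. Suc j < m}"
  proof (rule set_eqI, rule iffI)
    fix e assume "e \<in> graph_edges (path_verts m) path_adj"
    then obtain u v where "e = {u, v}" "u < m" "v < m" "u + 1 = v \<or> v + 1 = u"
      by (auto simp: graph_edges_def path_verts_def path_adj_def)
    then show "e \<in> {{j, Suc j} |j. Suc j < m}" by auto
  next
    fix e assume "e \<in> {{j, Suc j} |j. Suc j < m}"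
    then obtain j where "e = {j, Suc j}" "Suc j < m" by auto
    then show "e \<in> graph_edges (path_verts m) path_adj"
      unfolding graph_edges_def path_verts_def path_adj_def
      by (intro CollectI exI[of _ j] exI[of _ "Suc j"]) auto
  qed
  then show ?thesis
    by (auto simp: corona_verts_def path_verts_def complete_verts_def clq_def)
qed

lemma doubleton_Suc_eq_iff: "{i, Suc i} = {j, Suc j} \<longleftrightarrow> i = j"
  by (auto simp: doubleton_eq_iff)

lemma pk_adj_simps:
  "path_adj a b \<longleftrightarrow> Suc a = b \<or> Suc b = a"
  "pk_adj (Inl a) (clq j h) \<longleftrightarrow> a = j \<or> a = Suc j"
  "pk_adj (clq j h) (Inl a) \<longleftrightarrow> a = j \<or> a = Suc j"
  "pk_adj (clq i h) (clq j h') \<longleftrightarrow> i = j \<and> h \<noteq> h'"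
  by (simp_all add: clq_def path_adj_def complete_adj_def doubleton_Suc_eq_iff)

lemma clq_eq_simps [simp]:
  "clq i h = clq j h' \<longleftrightarrow> i = j \<and> h = h'" "clq i h \<noteq> Inl a" "Inl a \<noteq> clq i h"
  by (auto simp: clq_def doubleton_Suc_eq_iff)

lemma pk_adj_sym: "pk_adj x y \<Longrightarrow> pk_adj y x"
  by (cases x; cases y) (auto simp: path_adj_def complete_adj_def)

text \<open>Level 0 is \<open>Inl 0\<close> alone; a later level \<open>i\<close> joins
  \<open>Inl i\<close> with the clique on the edge from \<open>i - 1\<close> to \<open>i\<close>.
  Each level is a clique, and edges to the next level start at its path vertex.\<close>

fun level :: "nat + nat set \<times> nat \<Rightarrow> nat" where
  "level (Inl i) = i"
| "level (Inr (e, h)) = Max e"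

lemma level_clq [simp]: "level (clq j h) = Suc j"
  by (simp add: clq_def)

lemma level_less: "x \<in> pk_verts m n \<Longrightarrow> level x < m"
  by (auto simp: mem_pk_verts)

lemma level_lipschitz:
  "x \<in> pk_verts m n \<Longrightarrow> y \<in> pk_verts m n \<Longrightarrow> pk_adj x y \<Longrightarrow> level x \<le> Suc (level y)"
  by (auto simp: mem_pk_verts pk_adj_simps)

lemma level_crossing:
  assumes "x \<in> pk_verts m n" "y \<in> pk_verts m n" "pk_adj x y" "level x \<le> i" "i < level y"
  shows "x = Inl i"
  using assms by (auto simp: mem_pk_verts pk_adj_simps)

lemma pk_adj_same_level:
  assumes "x \<in> pk_verts m n" "y \<in> pk_verts m n" "level x = level y" "x \<noteq> y"
  shows "pk_adj x y"
  using assms by (auto simp: mem_pk_verts pk_adj_simps)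

lemma is_path_up:
  assumes "v \<in> pk_verts m n" "i < level v"
  shows "is_path (pk_verts m n) pk_adj (map Inl [i..<level v] @ [v]) (Inl i) v"
proof -
  have "pk_adj (Inl (level v - 1)) v"
    using assms by (auto simp: mem_pk_verts pk_adj_simps)
  moreover have "set (map Inl [i..<level v]) \<subseteq> pk_verts m n"
    using level_less[OF assms(1)] by (auto simp: mem_pk_verts)
  moreover have "v \<notin> set (map Inl [i..<level v])"
    by auto
  moreover have "successively pk_adj (map Inl [i..<level v])"
    by (auto simp: successively_conv_nth pk_adj_simps)
  ultimately show ?thesis
    using assms
    by (auto simp: is_path_iff_successively successively_append_iff last_map hd_map hd_append
        distinct_map)
qed

text \<open>Vertices on one level are adjacent. Otherwise climb along the path vertices, entering
  them on the level of \<open>u\<close> if \<open>u\<close> is a clique vertex; that level is at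
  least 1, so \<open>Inl 0\<close> is never internal.\<close>

lemma ex_path_internal:
  assumes "u \<in> pk_verts m n" "v \<in> pk_verts m n" "u \<noteq> v" "level u \<le> level v"
  shows "\<exists>p. is_path (pk_verts m n) pk_adj p u v \<and> set (butlast (tl p)) \<subseteq> Inl ` {1..<m-1}"
proof (cases "level u = level v")
  case True
  with assms have "is_path (pk_verts m n) pk_adj [u, v] u v"
    using pk_adj_same_level by (simp add: is_path_iff_successively)
  then show ?thesis by (intro exI[of _ "[u, v]"]) simp
next
  case False
  let ?p = "map Inl [level u..<level v] @ [v]"
  have less: "level u < level v" and p: "is_path (pk_verts m n) pk_adj ?p (Inl (level u)) v"
    using False assms is_path_up[of v m n "level u"] by auto
  have "level v < m"
    using assms(2) by (rule level_less)
  from assms(1) consider "u = Inl (level u)" | j h where "u = clq j h"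
    by (auto simp: mem_pk_verts)
  then show ?thesis
  proof cases
    case 1
    have "set (butlast (tl ?p)) \<subseteq> Inl ` {1..<m-1}"
      using less \<open>level v < m\<close> by (auto simp: tl_append map_tl tl_upt upt_conv_Cons butlast_append)
    with p 1 show ?thesis by metis
  next
    case 2
    with p assms(1) less have "is_path (pk_verts m n) pk_adj (u # ?p) u v"
      by (auto simp: is_path_iff_successively successively_Cons pk_adj_simps)
    moreover have "set (butlast (tl (u # ?p))) \<subseteq> Inl ` {1..<m-1}"
      using less \<open>level v < m\<close> 2 by (auto simp: butlast_append)
    ultimately show ?thesis by blast
  qed
qed

lemma rainbow_vertex_coloring_pkI:
  assumes "\<And>x. x \<in> pk_verts m n \<Longrightarrow> c x \<in> {1..k}" "inj_on c (Inl ` {1..<m-1})"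
  shows "rainbow_vertex_coloring (pk_verts m n) pk_adj k c"
proof -
  have "\<exists>p. is_path (pk_verts m n) pk_adj p u v \<and> inj_on c (set (butlast (tl p)))"
    if uv: "u \<in> pk_verts m n" "v \<in> pk_verts m n" "u \<noteq> v" for u v
  proof (cases "level u \<le> level v")
    case True
    then show ?thesis
      using ex_path_internal[OF uv] assms(2) by (meson inj_on_subset)
  next
    case False
    then obtain p where p: "is_path (pk_verts m n) pk_adj p v u"
      "set (butlast (tl p)) \<subseteq> Inl ` {1..<m-1}"
      using ex_path_internal[of v m n u] uv by auto
    have "set (butlast (tl (rev p))) = set (butlast (tl p))"
      by (metis butlast_rev butlast_tl rev_swap set_rev)
    then show ?thesis
      using is_path_rev[OF p(1) pk_adj_sym] p(2) assms(2) by (metis inj_on_subset)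
  qed
  with assms(1) show ?thesis
    by (auto simp: rainbow_vertex_coloring_def)
qed

section \<open>The lower bound\<close>

text \<open>A path from \<open>Inl 0\<close> to \<open>Inl (m-1)\<close> must pass every inner
  \<open>Inl i\<close>, so \<open>c \<circ> Inl\<close> is a rainbow colouring of the path.\<close>

lemma rainbow_imp_rvc_path_le:
  assumes "m \<ge> 2" "rainbow_vertex_coloring (pk_verts m n) pk_adj k c"
  shows "rvc (path_verts m) path_adj \<le> k"
proof (rule rvc_path_le)
  show "m \<ge> 1" using assms(1) by simp
  show "(c \<circ> Inl) ` {..<m} \<subseteq> {1..k}"
    using assms(2) by (fastforce simp: rainbow_vertex_coloring_def mem_pk_verts)
  have "Inl 0 \<in> pk_verts m n" "Inl (m-1) \<in> pk_verts m n" "Inl 0 \<noteq> (Inl (m-1) :: nat + nat set \<times> nat)"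
    using assms(1) by (auto simp: mem_pk_verts)
  with assms(2) obtain p where p: "is_path (pk_verts m n) pk_adj p (Inl 0) (Inl (m-1))"
    "inj_on c (set (butlast (tl p)))"
    unfolding rainbow_vertex_coloring_def by blast
  have "Inl i \<in> set (butlast (tl p))" if i: "1 \<le> i" "i < m - 1" for i
  proof -
    from p(1) i obtain x y where xy: "x \<in> set p" "y \<in> set p" "pk_adj x y" "level x \<le> i" "i < level y"
      using successively_crossing[of pk_adj p "\<lambda>x. level x \<le> i"]
      by (auto simp: is_path_iff_successively)
    then have "x = Inl i"
      using p(1) level_crossing[of x m n y i] by (auto simp: is_path_def)
    then show ?thesis
      using mem_internal[OF p(1)] xy(1) i by auto
  qed
  then have "inj_on c (Inl ` {1..<m-1})"
    by (intro inj_on_subset[OF p(2)]) auto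
  then show "inj_on (c \<circ> Inl) {1..<m-1}"
    by (intro comp_inj_on) auto
qed

lemma locating_imp_le:
  assumes "m \<ge> 2" "locating_rainbow_coloring (pk_verts m n) pk_adj k c"
  shows "n + 2 \<le> k"
proof (rule ccontr)
  assume "\<not> n + 2 \<le> k"
  then have k: "k \<le> n + 1" by simp
  let ?V = "pk_verts m n"
  let ?L = "insert (Inl 0) (clq 0 ` {..<n})"
  have LV: "?L \<subseteq> ?V" and a1: "Inl 1 \<in> ?V"
    using assms(1) by (auto simp: mem_pk_verts)
  have col: "c x \<in> {1..k}" if "x \<in> ?V" for x
    using assms(2) that by (auto simp: locating_rainbow_coloring_def rainbow_vertex_coloring_def)
  have loc: "u = v" if "u \<in> ?V" "v \<in> ?V" "rainbow_code ?V pk_adj k c u = rainbow_code ?V pk_adj k c v" for u v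
    using assms(2) that by (auto simp: locating_rainbow_coloring_def)
  have "inj_on c ?L"
  proof (rule inj_onI)
    fix u v assume uv: "u \<in> ?L" "v \<in> ?L" "c u = c v"
    \<comment> \<open>The set \<open>?L\<close> is a clique whose only outside neighbour is
      \<open>Inl 1\<close>, for each of its vertices.\<close>
    have "pk_adj u w \<longleftrightarrow> pk_adj v w" if "w \<in> ?V" "w \<noteq> u" "w \<noteq> v" for w
      using uv(1,2) that by (auto simp: mem_pk_verts pk_adj_simps)
    with uv LV show "u = v"
      by (intro loc rainbow_code_twins) auto
  qed
  moreover have "card ?L = n + 1"
    by (subst card_insert_disjoint) (auto simp: card_image inj_on_def)
  ultimately have "card (c ` ?L) = n + 1"
    by (metis card_image)
  moreover have "c ` ?L \<subseteq> {1..k}"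
    using col LV by blast
  ultimately have cL: "c ` ?L = {1..k}"
    using k by (intro card_seteq) auto
  \<comment> \<open>\<open>?L\<close> carries all colours and forms a clique together with
    \<open>Inl 1\<close>.\<close>
  have near: "set_dist ?V pk_adj u {x\<in>?V. c x = i} < 2"
    if "i \<in> {1..k}" "u \<in> insert (Inl 1) ?L" for i u
  proof -
    from that(1) cL obtain x where x: "x \<in> ?L" "c x = i" by (metis imageE)
    have "u = x \<or> pk_adj u x"
      using that(2) x(1) by (auto simp: pk_adj_simps)
    moreover have "u \<in> ?V" using that(2) LV a1 by blast
    ultimately show ?thesis
      using x LV by (subst set_dist_less_2_iff) auto
  qed
  obtain x where x: "x \<in> ?L" "c x = c (Inl 1)"
    using col[OF a1] cL by (metis imageE)
  then have "x = Inl 1"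
    using LV a1 near by (intro loc rainbow_code_eq_if_near) auto
  with x(1) show False by auto
qed

section \<open>A locating coloring\<close>

text \<open>The clique on level \<open>j\<close> is coloured by \<open>{2..n+2}\<close> without \<open>gap n j\<close>; this is the colour of the
  path vertex on level \<open>j\<close> whenever \<open>j \<ge> 2\<close> and that colour is at most \<open>n + 2\<close>.\<close>

definition gap :: "nat \<Rightarrow> nat \<Rightarrow> nat" where
  "gap n j = (if j = 1 then n + 2 else min j (n + 2))"

text \<open>Inner path vertices are coloured by position, hence distinctly by 1 to
  \<open>m - 2\<close>. Position \<open>m - 1\<close> may exceed the number of colours, so the last
  vertex takes the gap of its level. The shift to \<open>h + 3\<close> skips the gap.\<close>

fun pk_col :: "nat \<Rightarrow> nat \<Rightarrow> nat + nat set \<times> nat \<Rightarrow> nat" where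
  "pk_col m n (Inl i) = (if i = 0 then 1 else if Suc i = m then gap n i else i)"
| "pk_col m n (Inr (e, h)) = (if h + 2 < gap n (Max e) then h + 2 else h + 3)"

lemma pk_col_clq [simp]:
  "pk_col m n (clq j h) = (if h + 2 < gap n (Suc j) then h + 2 else h + 3)"
  by (simp add: clq_def)

text \<open>The path vertex of a level has the gap as its colour or a colour outside
  \<open>{2..n+2}\<close>, so only vertices on different levels remain to be separated.\<close>

lemma inj_on_pk_col_level:
  assumes "u \<in> pk_verts m n" "v \<in> pk_verts m n" "level u = level v" "pk_col m n u = pk_col m n v"
  shows "u = v"
  using assms by (auto simp: mem_pk_verts gap_def split: if_splits)

lemma pk_col_eq_1_iff:
  assumes "m \<ge> 2" "v \<in> pk_verts m n"
  shows "pk_col m n v = 1 \<longleftrightarrow> v = Inl 0 \<or> m > 2 \<and> v = Inl 1"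
  using assms by (auto simp: mem_pk_verts gap_def min_def split: if_splits)

lemma locating_pk_col:
  assumes m: "m \<ge> 2" and n: "n \<ge> 1" and k: "n + 2 \<le> k" "m - 2 \<le> k"
  shows "locating_rainbow_coloring (pk_verts m n) pk_adj k (pk_col m n)"
proof -
  let ?V = "pk_verts m n"
  let ?c = "pk_col m n"
  let ?R = "\<lambda>i. {x\<in>?V. ?c x = i}"
  have col: "?c x \<in> {1..k}" if "x \<in> ?V" for x
    using that k by (auto simp: mem_pk_verts gap_def)
  have rainbow: "rainbow_vertex_coloring ?V pk_adj k ?c"
    using col by (intro rainbow_vertex_coloring_pkI) (auto simp: inj_on_def)
  have "rainbow_code ?V pk_adj k ?c u \<noteq> rainbow_code ?V pk_adj k ?c v"
    if u: "u \<in> ?V" and v: "v \<in> ?V" and less: "level u < level v" for u v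
  proof
    assume eq: "rainbow_code ?V pk_adj k ?c u = rainbow_code ?V pk_adj k ?c v"
    then have c: "?c u = ?c v"
      using rainbow_code_eq_imp_color_eq[of u ?V v ?c k] u v col by blast
    have dist: "set_dist ?V pk_adj u (?R i) = set_dist ?V pk_adj v (?R i)" if "i \<in> {1..k}" for i
      using eq that by (simp add: rainbow_code_eq_iff)
    have bot: "u = Inl 0 \<or> (\<exists>h<n. u = clq 0 h)" and top: "v = Inl 1 \<or> level v = 2" and "m > 2"
    proof (atomize (full), cases "level u = 0")
      case True
      then have "u = Inl 0"
        using u by (auto simp: mem_pk_verts)
      with c less m have "m > 2 \<and> v = Inl 1"
        using pk_col_eq_1_iff[OF m u] pk_col_eq_1_iff[OF m v] by auto
      with \<open>u = Inl 0\<close> show "(u = Inl 0 \<or> (\<exists>h<n. u = clq 0 h)) \<and> (v = Inl 1 \<or> level v = 2) \<and> m > 2"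
        by simp
    next
      case False
      with less level_less[OF v] have "level v \<ge> 2" "m > 2" by auto
      then have "?c v \<noteq> 1"
        using pk_col_eq_1_iff[OF m v] by auto
      with c \<open>m > 2\<close> have "u \<noteq> Inl 1" by auto
      \<comment> \<open>\<open>Inl b\<close> is the highest vertex of colour 1 strictly below the
        level of \<open>u\<close>.\<close>
      define b where "b = (if level u = 1 then 0 else 1 :: nat)"
      have "b < level u" "Inl b \<in> ?R 1"
        using False \<open>m > 2\<close> by (auto simp: b_def mem_pk_verts)
      have "enat (level v - 1) \<le> set_dist ?V pk_adj v (?R 1)"
        unfolding set_dist_def
      proof (rule Inf_greatest, clarify)
        fix x assume x: "x \<in> ?V" "?c x = 1"
        then have "level x \<le> 1"
          using pk_col_eq_1_iff[OF m x(1)] by auto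
        then have "enat (level v - 1) \<le> enat (level v - level x)"
          by simp
        also have "\<dots> \<le> gdist ?V pk_adj v x"
          by (rule gdist_ge_lipschitz) (rule level_lipschitz)
        finally show "enat (level v - 1) \<le> gdist ?V pk_adj v x" .
      qed
      also have "\<dots> = set_dist ?V pk_adj u (?R 1)"
        using dist[of 1] k by simp
      also have "\<dots> \<le> gdist ?V pk_adj u (Inl b)"
        using \<open>Inl b \<in> ?R 1\<close> by (rule set_dist_le)
      also have "\<dots> \<le> enat (level u - b)"
        using gdist_le[OF is_path_rev[OF is_path_up[OF u \<open>b < level u\<close>] pk_adj_sym]] by simp
      \<comment> \<open>As \<open>level u < level v\<close>, this excludes \<open>b = 1\<close>;
        \<open>b = 0\<close> means that \<open>u\<close> is on level 1 and then \<open>v\<close> on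
        level 2.\<close>
      finally have "level v - 1 \<le> level u - b" by simp
      with less False have "level u = 1" "level v = 2"
        by (auto simp: b_def split: if_splits)
      then show "(u = Inl 0 \<or> (\<exists>h<n. u = clq 0 h)) \<and> (v = Inl 1 \<or> level v = 2) \<and> m > 2"
        using u \<open>u \<noteq> Inl 1\<close> \<open>m > 2\<close> by (auto simp: mem_pk_verts)
    qed
    \<comment> \<open>The gap on level 2 is 2, so the last vertex of that clique has colour
      \<open>(n-1) + 3\<close>.\<close>
    have "clq 1 (n-1) \<in> ?R (n+2)"
      using n \<open>m > 2\<close> by (auto simp: mem_pk_verts gap_def)
    moreover have "v = clq 1 (n-1) \<or> pk_adj v (clq 1 (n-1))"
      using top v by (auto simp: mem_pk_verts pk_adj_simps)
    ultimately have "set_dist ?V pk_adj v (?R (n+2)) < 2"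
      using v by (subst set_dist_less_2_iff) auto
    then have "set_dist ?V pk_adj u (?R (n+2)) < 2"
      using dist k by simp
    then obtain x where "x \<in> ?V" "?c x = n + 2" "u = x \<or> pk_adj u x"
      using u by (subst (asm) set_dist_less_2_iff) auto
    \<comment> \<open>The gap on level 1 is \<open>n + 2\<close>, so the first clique avoids this
      colour; \<open>Inl 0\<close> and \<open>Inl 1\<close> have colour 1. Thus \<open>u\<close>
      neither has colour \<open>n + 2\<close> nor sees it.\<close>
    with bot \<open>m > 2\<close> show False
      by (auto simp: mem_pk_verts pk_adj_simps gap_def split: if_splits)
  qed
  then have "u = v" if "u \<in> ?V" "v \<in> ?V" "rainbow_code ?V pk_adj k ?c u = rainbow_code ?V pk_adj k ?c v" for u v
    using that inj_on_pk_col_level rainbow_code_eq_imp_color_eq[of u ?V v ?c k] col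
    by (metis linorder_neqE_nat)
  with rainbow show ?thesis
    by (auto simp: locating_rainbow_coloring_def)
qed

theorem theorem5:
  fixes m n :: nat
  assumes "m \<ge> 2" and "n \<ge> 2"
  shows "rvcl (corona_verts (path_verts m) path_adj (complete_verts n)) (corona_adj path_adj complete_adj)
         = max (rvc (path_verts m) path_adj) (n + 2)"
proof -
  let ?K = "max (rvc (path_verts m) path_adj) (n + 2)"
  have "\<exists>c. locating_rainbow_coloring (pk_verts m n) pk_adj ?K c"
    using locating_pk_col[of m n ?K] rvc_path_ge[of m] assms by fastforce
  moreover have "?K \<le> k" if "\<exists>c. locating_rainbow_coloring (pk_verts m n) pk_adj k c" for k
    using that assms(1) locating_imp_le rainbow_imp_rvc_path_le
    by (auto simp: locating_rainbow_coloring_def)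
  ultimately show ?thesis
    unfolding rvcl_def by (intro Least_equality) auto
qed

end
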